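(* There exists a metric space $(X,d_X)$ which is not Markov $p$-convex for any $p\in(0,\infty)$, yet $\lim_{n\to\infty}c_X(B_n)=\infty$. In fact, $(X,d_X)$ can be a doubling metric space, and hence $c_X(B_n)\ge 2^{\kappa n}$ for some constant $\kappa>0$.
   Context: $B_n$ is the complete unweighted binary tree of depth $n$, equipped with the shortest-path metric. For metric spaces $(\mathscr{M},d_{\mathscr{M}})$ and $(\mathscr{N},d_{\mathscr{N}})$, $c_{\mathscr{M}}(\mathscr{N})$ is the infimum of those $D>0$ for which there exist $r>0$ and $f:\mathscr{N}\to\mathscr{M}$ with $r\,d_{\mathscr{N}}(x,y)\le d_{\mathscr{M}}(f(x),f(y))\le Dr\,d_{\mathscr{N}}(x,y)$ for all $x,y\in\mathscr{N}$ (and $c_{\mathscr{M}}(\mathscr{N})=\infty$ if no such $f$ exists). A metric space is doubling if there is $\lambda\in\mathbb{N}$ such that every ball can be covered by at most $\lambda$ balls of half its radius. Markov $p$-convexity: let $\{X_t\}_{t\in \mathbb{Z}}$ be a Markov chain on a state space $\Omega$. Given an integer $k$, $\{\widetilde X_t(k)\}_{t\in \mathbb{Z}}$ denotes the process which equals $X_t$ for times $t\le k$, and evolves independently (with respect to the same transition probabilities) for times $t>k$. For $p>0$, a metric space $(X,d_X)$ is called Markov $p$-convex with constant $\Pi$ if for every Markov chain $\{X_t\}_{t\in \mathbb{Z}}$ on a state space $\Omega$ and every $f:\Omega\to X$, $$\sum_{k=0}^{\infty}\sum_{t\in \mathbb{Z}}\frac{\mathbb{E}\left[d_X\left(f(X_t),f\left(\widetilde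 X_t\left(t-2^{k}\right)\right)\right)^p\right]}{2^{kp}}\le \Pi^p\sum_{t\in \mathbb{Z}}\mathbb{E}\left[d_X(f(X_t),f(X_{t-1}))^p\right].$$ $X$ is called Markov $p$-convex if this holds for some $\Pi<\infty$.
   Formalization: The bound c_X(B_n) ≥ 2^{κn} is stated for all sufficiently large n; for every n it is false, since B_0 is a single point and c_X(B_0) = 0 < 1. *)

theory Defs
  imports "HOL-Probability.Probability"
begin

text \<open>Vertices of \<open>B\<^sub>n\<close> are the binary words of length at most \<open>n\<close>; the children of \<open>u\<close> are
  \<open>b # u\<close>.\<close>

definition tree_vertices :: "nat \<Rightarrow> bool list set" where
  "tree_vertices n = {u. length u \<le> n}"

definition tree_edges :: "nat \<Rightarrow> (bool list \<times> bool list) set" where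
  "tree_edges n = {(u, v). u \<in> tree_vertices n \<and> v \<in> tree_vertices n \<and>
                           (\<exists>b. v = b # u \<or> u = b # v)}"

text \<open>\<open>(u, v) \<in> E ^^ k\<close> says that there is a walk with \<open>k\<close> edges from \<open>u\<close> to \<open>v\<close>.\<close>

definition tree_dist :: "nat \<Rightarrow> bool list \<Rightarrow> bool list \<Rightarrow> real" where
  "tree_dist n u v = real (LEAST k. (u, v) \<in> tree_edges n ^^ k)"

text \<open>The infimum of the empty set is \<open>\<infinity>\<close> in \<^typ>\<open>ereal\<close>, so \<open>distortion M d N e = \<infinity>\<close> when
  \<open>N\<close> has no bilipschitz embedding into \<open>M\<close>.\<close>

definition distortion ::
  "'a set \<Rightarrow> ('a \<Rightarrow> 'a \<Rightarrow> real) \<Rightarrow> 'b set \<Rightarrow> ('b \<Rightarrow> 'b \<Rightarrow> real) \<Rightarrow> ereal" where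
  "distortion M d N e = Inf {ereal D | D. D > 0 \<and> (\<exists>r>0. \<exists>f \<in> N \<rightarrow> M. \<forall>x\<in>N. \<forall>y\<in>N.
     r * e x y \<le> d (f x) (f y) \<and> d (f x) (f y) \<le> D * r * e x y)}"

definition doubling :: "'a set \<Rightarrow> ('a \<Rightarrow> 'a \<Rightarrow> real) \<Rightarrow> bool" where
  "doubling M d \<longleftrightarrow> (\<exists>l::nat. \<forall>x\<in>M. \<forall>r>0. \<exists>C\<subseteq>M. finite C \<and> card C \<le> l \<and>
     Metric_space.mcball M d x r \<subseteq> (\<Union>c\<in>C. Metric_space.mcball M d c (r / 2)))"

text \<open>A Markov chain indexed by the integers on a countable state space, with transition
  probabilities \<open>K t a b\<close> from \<open>a\<close> at time \<open>t\<close> to \<open>b\<close> at time \<open>t + 1\<close> that may depend on \<open>t\<close>.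
  The last clause is the Markov property, multiplied by the probability of the
  conditioning event \<open>X\<^sub>s = x\<^sub>s\<close> (\<open>t - n \<le> s \<le> t\<close>), which may be null.\<close>

definition markov_chain ::
  "'m measure \<Rightarrow> (int \<Rightarrow> 's::countable \<Rightarrow> 's pmf) \<Rightarrow> (int \<Rightarrow> 'm \<Rightarrow> 's) \<Rightarrow> bool" where
  "markov_chain P K X \<longleftrightarrow> prob_space P \<and> (\<forall>t. X t \<in> P \<rightarrow>\<^sub>M count_space UNIV) \<and>
     (\<forall>t x. \<forall>n::nat.
        measure P {w \<in> space P. \<forall>s\<in>{t - int n..t + 1}. X s w = x s} =
        measure P {w \<in> space P. \<forall>s\<in>{t - int n..t}. X s w = x s} * pmf (K t (x t)) (x (t + 1)))"

text \<open>\<open>Y\<close> agrees with \<open>X\<close> up to time \<open>k\<close>; afterwards, conditionally on the whole trajectory of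
  \<open>X\<close>, it moves according to the transition probabilities \<open>K\<close>. The trajectory of \<open>X\<close> enters
  through its restrictions to arbitrarily large finite windows around \<open>k\<close>.\<close>

definition independent_continuation ::
  "'m measure \<Rightarrow> (int \<Rightarrow> 's::countable \<Rightarrow> 's pmf) \<Rightarrow> (int \<Rightarrow> 'm \<Rightarrow> 's) \<Rightarrow> int \<Rightarrow> (int \<Rightarrow> 'm \<Rightarrow> 's) \<Rightarrow> bool"
  where
  "independent_continuation P K X k Y \<longleftrightarrow> (\<forall>t. Y t \<in> P \<rightarrow>\<^sub>M count_space UNIV) \<and>
     (\<forall>t\<le>k. \<forall>w\<in>space P. Y t w = X t w) \<and>
     (\<forall>t\<ge>k. \<forall>x y. \<forall>n::nat.
        measure P {w \<in> space P. (\<forall>s\<in>{k - int n..k + int n}. X s w = x s) \<and>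
                                 (\<forall>s\<in>{k..t + 1}. Y s w = y s)} =
        measure P {w \<in> space P. (\<forall>s\<in>{k - int n..k + int n}. X s w = x s) \<and>
                                 (\<forall>s\<in>{k..t}. Y s w = y s)} * pmf (K t (y t)) (y (t + 1)))"

text \<open>Fixing the types \<^typ>\<open>nat\<close> of states and \<^typ>\<open>real\<close> of sample points loses nothing:
  every countable state space embeds into \<^typ>\<open>nat\<close>, and the joint law of a chain and all of
  its continuations, a Borel probability measure on a Polish space, is realised on the real
  line. Expectations and sums are taken in \<^typ>\<open>ennreal\<close>, so both sides may be infinite.\<close>

definition markov_convex_with :: "'a set \<Rightarrow> ('a \<Rightarrow> 'a \<Rightarrow> real) \<Rightarrow> real \<Rightarrow> real \<Rightarrow> bool" where
  "markov_convex_with M d p C \<longleftrightarrow>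
     (\<forall>(P :: real measure) (K :: int \<Rightarrow> nat \<Rightarrow> nat pmf) X Y. \<forall>f \<in> UNIV \<rightarrow> M.
        markov_chain P K X \<longrightarrow> (\<forall>k. independent_continuation P K X k (Y k)) \<longrightarrow>
        (\<Sum>\<^sub>\<infinity>k::nat. \<Sum>\<^sub>\<infinity>t::int.
           (\<integral>\<^sup>+w. ennreal (d (f (X t w)) (f (Y (t - 2 ^ k) t w)) powr p) \<partial>P)
             / ennreal (2 powr (real k * p)))
        \<le> ennreal (C powr p) *
          (\<Sum>\<^sub>\<infinity>t::int. \<integral>\<^sup>+w. ennreal (d (f (X t w)) (f (X (t - 1) w)) powr p) \<partial>P))"

definition markov_convex :: "'a set \<Rightarrow> ('a \<Rightarrow> 'a \<Rightarrow> real) \<Rightarrow> real \<Rightarrow> bool" where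
  "markov_convex M d p \<longleftrightarrow> (\<exists>C\<ge>0. markov_convex_with M d p C)"

end

theory Submission
  imports Defs "HOL-Real_Asymp.Real_Asymp"
begin

text \<open>
  The space is a countable relative of the infinite Laakso graph. Its points consist of a time
  \<open>t \<ge> 0\<close> together with, for each scale \<open>i\<close>, a height \<open>\<plusminus>tent i t\<close>, where \<open>tent i\<close> is a bump of
  height \<open>4 ^ i\<close> over the middle half of each period of length \<open>4 ^ (i + 1)\<close>; the signs are
  arbitrary, and the distance is the supremum distance. So during each bump the time line splits
  into two sides, which start and end together and drift apart in between.

  It is not Markov \<open>p\<close>-convex for any \<open>p\<close> (\<open>not_markov_convex_laakso\<close>). Let a walk advance
  by one time unit per step and toss a fair coin for the side whenever a bump begins. It has speed
  at most one. If the walk is rerun from \<open>4 ^ i\<close> steps ago and a bump of scale \<open>i\<close> has begun since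
  then, the two copies are on different sides with probability one half; for one eighth of all
  times they are then at least \<open>4 ^ i\<close> apart. As \<open>4 ^ i = 2 ^ (2 * i)\<close>, every scale contributes to
  the left-hand side of the defining inequality a fixed proportion of the number of steps, whatever
  \<open>p\<close> is, and the number of scales is unbounded.

  It is doubling (\<open>doubling_laakso\<close>), because bumps of scale \<open>i\<close> begin and end at odd multiples of
  \<open>4 ^ i\<close>. A ball of radius \<open>r\<close> with \<open>4 ^ j \<le> r < 4 ^ (j + 1)\<close> therefore meets ends of bumps of at
  most one scale \<open>\<ge> j + 2\<close>, and at the other large scales it lies on one side only. At scales below
  \<open>j\<close> the bumps are too low to matter. What is left are the time and three signs.

  Doubling spaces do not contain large trees with small distortion (\<open>doubling_tree_distortion\<close>): the \<open>2 ^ n\<close> leaves of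
  the tree are sent to points with mutual distances at least \<open>r\<close> in a ball of radius \<open>D * r * n\<close>,
  and the number of such points is at most polynomial in \<open>D * n\<close>. So \<open>D\<close> grows exponentially with
  \<open>n\<close>. Being countable, the space can finally be replaced by a set of real numbers.
\<close>

section \<open>Bumps on a time line\<close>

text \<open>A bump of height \<open>4 ^ i\<close> over the middle half of every period of length \<open>4 ^ (i + 1)\<close>. The
  bumps of scale \<open>i\<close> start and end at odd multiples of \<open>4 ^ i\<close>; leaving out the outer quarters of
  a period makes bumps of different scales start and end far apart from each other, which is what
  doubling depends on.\<close>

definition tent :: "nat \<Rightarrow> int \<Rightarrow> int" where
  "tent i t = max 0 (4 ^ i - \<bar>t mod 4 ^ Suc i - 2 * 4 ^ i\<bar>)"

lemma tent_nonneg: "0 \<le> tent i t"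
  and tent_le: "tent i t \<le> 4 ^ i"
  by (auto simp: tent_def)

lemma tent_eq_0: "tent i t = 0" if "0 \<le> t" "t \<le> 4 ^ i"
proof -
  have "t mod 4 ^ Suc i = t"
    using that by (intro mod_pos_pos_trivial) (auto intro: order_le_less_trans)
  then show ?thesis using that by (simp add: tent_def)
qed

lemma tent_step: "\<bar>tent i (t + 1) - tent i t\<bar> \<le> 1"
proof -
  define N :: int where "N = 4 ^ i"
  have N: "N > 0" "4 ^ Suc i = 4 * N" by (simp_all add: N_def)
  have "(t + 1) mod (4 * N) = (t mod (4 * N) + 1) mod (4 * N)" by (simp add: mod_add_left_eq)
  moreover have "0 \<le> t mod (4 * N)" "t mod (4 * N) < 4 * N" using N(1) by auto
  moreover have "(u + 1) mod (4 * N) = (if u = 4 * N - 1 then 0 else u + 1)"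
    if "0 \<le> u" "u < 4 * N" for u using that by auto
  ultimately have "(t + 1) mod (4 * N) = (if t mod (4 * N) = 4 * N - 1 then 0 else t mod (4 * N) + 1)"
    by metis
  then show ?thesis unfolding tent_def N(2) N_def[symmetric]
    using N(1) by (auto simp: max_def abs_if)
qed

lemma tent_Lipschitz: "\<bar>tent i s - tent i t\<bar> \<le> \<bar>s - t\<bar>"
proof -
  have *: "\<bar>tent i (t + int n) - tent i t\<bar> \<le> int n" for t n
  proof (induction n)
    case (Suc n)
    then show ?case using tent_step[of i "t + int n"] by (simp add: algebra_simps)
  qed simp
  show ?thesis
    using *[of t "nat (s - t)"] *[of s "nat (t - s)"] by (cases "s \<le> t") auto
qed

text \<open>If the bump of scale \<open>i\<close> is low at \<open>s\<close> but does not vanish throughout the interval of radius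
  \<open>R\<close> around \<open>s\<close>, then a bump starts or ends within \<open>R\<close> of \<open>s\<close>: either \<open>s\<close> lies inside a bump, whose
  height at \<open>s\<close> is the distance to the closer end, or an end separates \<open>s\<close> from \<open>t\<close>.\<close>

lemma near_odd_multiple:
  assumes "tent i s \<le> R" "\<bar>s - t\<bar> \<le> R" "tent i t > 0"
  obtains q where "odd q" "\<bar>s - q * 4 ^ i\<bar> \<le> R"
proof -
  define N :: int where "N = 4 ^ i"
  have N: "N > 0" "4 ^ Suc i = 4 * N" by (simp_all add: N_def)
  define q \<rho> q' \<rho>' where "q = s div (4 * N)" and "\<rho> = s mod (4 * N)"
    and "q' = t div (4 * N)" and "\<rho>' = t mod (4 * N)"
  have s: "s = 4 * N * q + \<rho>" "0 \<le> \<rho>" "\<rho> < 4 * N"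
    and t: "t = 4 * N * q' + \<rho>'" "0 \<le> \<rho>'" "\<rho>' < 4 * N"
    using N(1) by (auto simp: q_def \<rho>_def q'_def \<rho>'_def)
  have ts: "tent i s = max 0 (N - \<bar>\<rho> - 2 * N\<bar>)" and tt: "tent i t = max 0 (N - \<bar>\<rho>' - 2 * N\<bar>)"
    unfolding tent_def N(2) N_def[symmetric] \<rho>_def \<rho>'_def by auto
  have t': "N < \<rho>'" "\<rho>' < 3 * N" using assms(3) tt by auto
  \<comment> \<open>In different periods, the end facing \<open>s\<close> of the bump at \<open>t\<close> lies between \<open>s\<close> and \<open>t\<close>.\<close>
  consider "q < q'" | "q' < q" | "q = q'" by linarith
  then show thesis
  proof cases
    case 1
    then have "4 * N * (q + 1) \<le> 4 * N * q'" using N by (intro mult_left_mono) auto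
    then have "\<bar>s - (4 * q' + 1) * N\<bar> \<le> R"
      using assms(2) s t t' by (simp add: algebra_simps)
    then show ?thesis using that[of "4 * q' + 1"] by (simp add: N_def)
  next
    case 2
    then have "4 * N * (q' + 1) \<le> 4 * N * q" using N by (intro mult_left_mono) auto
    then have "\<bar>s - (4 * q' + 3) * N\<bar> \<le> R"
      using assms(2) s t t' by (simp add: algebra_simps)
    then show ?thesis using that[of "4 * q' + 3"] by (simp add: N_def)
  next
    case 3
    have "\<bar>s - (4 * q + 1) * N\<bar> \<le> R \<or> \<bar>s - (4 * q + 3) * N\<bar> \<le> R"
      using assms(1,2) s t t' ts 3 by (auto simp add: algebra_simps max_def abs_if split: if_splits)
    then show ?thesis using that[of "4 * q + 1"] that[of "4 * q + 3"] by (auto simp: N_def)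
  qed
qed

text \<open>Multiples of \<open>4 ^ i'\<close> with \<open>i' > i\<close> are even multiples of \<open>4 ^ i\<close>, so they stay \<open>4 ^ i\<close> away
  from the odd ones. Hence a short interval meets ends of bumps of at most one large scale.\<close>

lemma near_odd_multiple_unique:
  fixes s R q q' :: int
  assumes "odd q" "\<bar>s - q * 4 ^ i\<bar> \<le> R" "\<bar>s - q' * 4 ^ i'\<bar> \<le> R" "2 * R < 4 ^ i"
  shows "i' \<le> i"
proof (rule ccontr)
  assume "\<not> i' \<le> i"
  then obtain k where k: "i' = Suc (i + k)" by (metis less_iff_Suc_add not_le)
  define q'' where "q'' = q - 4 * 4 ^ k * q'"
  have eq: "q'' * 4 ^ i = (s - q' * 4 ^ i') - (s - q * 4 ^ i)"
    by (simp add: q''_def k power_add algebra_simps)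
  have "\<bar>q''\<bar> * 4 ^ i = \<bar>q'' * 4 ^ i\<bar>" by (simp add: abs_mult)
  also have "\<dots> < 1 * 4 ^ i" unfolding eq using assms(2-4) by linarith
  finally have "\<bar>q''\<bar> < 1" by (subst (asm) mult_less_cancel_right_pos) auto
  then have "q'' = 0" by simp
  then have "q = 4 * 4 ^ k * q'" by (simp add: q''_def)
  with assms(1) show False by simp
qed

section \<open>The metric space\<close>

text \<open>Coordinate \<open>0\<close> is a time and the other coordinates are the bumps at this time, with arbitrary
  signs. Over every bump the time line is thus doubled into two sides that share their end points,
  at all scales at once, as in the graphs of Laakso.\<close>

definition laakso_space :: "(nat \<Rightarrow> int) set" where
  "laakso_space = {x. 0 \<le> x 0 \<and> (\<forall>i. \<bar>x (Suc i)\<bar> = tent i (x 0))}"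

text \<open>On the space above the supremum is attained, because its points have finite support. The
  metric axioms also ask for nonnegative distances between all other elements of the type, which
  \<^const>\<open>nat\<close> ensures.\<close>

definition sup_dist :: "(nat \<Rightarrow> int) \<Rightarrow> (nat \<Rightarrow> int) \<Rightarrow> real" where
  "sup_dist x y = real (nat (Max (range (\<lambda>i. \<bar>x i - y i\<bar>))))"

lemma laakso_space_vanishes:
  assumes "x \<in> laakso_space" "i > nat (x 0)"
  shows "x i = 0"
proof -
  obtain j where j: "i = Suc j" using assms(2) by (cases i) auto
  have "nat (x 0) \<le> j" using assms j by simp
  also have "j < 4 ^ j" by (rule power_gt_expt) simp
  finally have "int (nat (x 0)) \<le> int (4 ^ j)" by linarith
  then have "x 0 \<le> 4 ^ j" using assms(1) by (simp add: laakso_space_def)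
  then show ?thesis using assms(1) j tent_eq_0[of "x 0" j] by (metis (mono_tags, lifting) abs_eq_0 laakso_space_def mem_Collect_eq)
qed

lemma countable_laakso_space: "countable laakso_space"
proof (rule countable_subset)
  show "laakso_space \<subseteq> range (\<lambda>l i. if i < length l then l ! i else (0::int))"
  proof
    fix x assume x: "x \<in> laakso_space"
    let ?l = "map x [0..<Suc (nat (x 0))]"
    have "x = (\<lambda>i. if i < length ?l then ?l ! i else 0)"
    proof
      fix i
      show "x i = (if i < length ?l then ?l ! i else 0)"
      proof (cases "i < Suc (nat (x 0))")
        case True
        then show ?thesis by (simp del: upt_Suc)
      next
        case False
        then show ?thesis using laakso_space_vanishes[OF x, of i] by (simp del: upt_Suc)
      qed
    qed
    then show "x \<in> range (\<lambda>l i. if i < length l then l ! i else (0::int))"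
      by (rule range_eqI)
  qed
qed simp

lemma sup_dist_le_iff:
  assumes "x \<in> laakso_space" "y \<in> laakso_space"
  shows "sup_dist x y \<le> r \<longleftrightarrow> (\<forall>i. real_of_int \<bar>x i - y i\<bar> \<le> r)"
proof -
  let ?F = "range (\<lambda>i. \<bar>x i - y i\<bar>)"
  have "?F \<subseteq> insert 0 ((\<lambda>i. \<bar>x i - y i\<bar>) ` {..max (nat (x 0)) (nat (y 0))})"
  proof
    fix a assume "a \<in> ?F"
    then obtain i where i: "a = \<bar>x i - y i\<bar>" by blast
    show "a \<in> insert 0 ((\<lambda>i. \<bar>x i - y i\<bar>) ` {..max (nat (x 0)) (nat (y 0))})"
    proof (cases "i \<le> max (nat (x 0)) (nat (y 0))")
      case True
      then show ?thesis using i by blast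
    next
      case False
      then have "x i = 0" "y i = 0" using assms by (auto intro!: laakso_space_vanishes)
      then show ?thesis using i by simp
    qed
  qed
  then have fin: "finite ?F" by (rule finite_subset) simp
  have "0 \<le> \<bar>x 0 - y 0\<bar>" by simp
  also have "\<dots> \<le> Max ?F" using fin by (intro Max_ge) auto
  finally have "sup_dist x y \<le> r \<longleftrightarrow> Max ?F \<le> \<lfloor>r\<rfloor>"
    by (simp add: sup_dist_def le_floor_iff)
  also have "\<dots> \<longleftrightarrow> (\<forall>i. \<bar>x i - y i\<bar> \<le> \<lfloor>r\<rfloor>)" using fin by (subst Max_le_iff) auto
  finally show ?thesis by (simp add: le_floor_iff)
qed

lemma coord_le_sup_dist:
  assumes "x \<in> laakso_space" "y \<in> laakso_space"
  shows "real_of_int \<bar>x i - y i\<bar> \<le> sup_dist x y"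
  using sup_dist_le_iff[OF assms, of "sup_dist x y"] by simp

lemma Metric_space_laakso: "Metric_space laakso_space sup_dist"
proof
  fix x y :: "nat \<Rightarrow> int"
  show "sup_dist x y = sup_dist y x" by (simp add: sup_dist_def abs_minus_commute)
  show "0 \<le> sup_dist x y" by (simp add: sup_dist_def)
next
  fix x y assume xy: "x \<in> laakso_space" "y \<in> laakso_space"
  show "sup_dist x y = 0 \<longleftrightarrow> x = y"
    using sup_dist_le_iff[OF xy, of 0] coord_le_sup_dist[OF xy, of 0] by (auto simp: fun_eq_iff)
next
  fix x y z assume *: "x \<in> laakso_space" "y \<in> laakso_space" "z \<in> laakso_space"
  show "sup_dist x z \<le> sup_dist x y + sup_dist y z"
  proof (subst sup_dist_le_iff[OF *(1,3)], rule allI)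
    fix i
    show "real_of_int \<bar>x i - z i\<bar> \<le> sup_dist x y + sup_dist y z"
      using coord_le_sup_dist[OF *(1,2), of i] coord_le_sup_dist[OF *(2,3), of i] by linarith
  qed
qed

section \<open>Doubling\<close>

text \<open>The covering balls are centred at representatives of the classes, because the centres have to
  lie in \<open>M\<close>. Balls of radius \<open>r / 2\<close> suffice, as the classes have diameter at most \<open>r / 2\<close>.\<close>

lemma doublingI_classification:
  assumes "Metric_space M d"
    and "\<And>x r. x \<in> M \<Longrightarrow> r > 0 \<Longrightarrow> \<exists>(g :: 'a \<Rightarrow> 'b) F. finite F \<and> card F \<le> l \<and>
      g ` Metric_space.mcball M d x r \<subseteq> F \<and>
      (\<forall>y\<in>Metric_space.mcball M d x r. \<forall>z\<in>Metric_space.mcball M d x r.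
         g y = g z \<longrightarrow> d y z \<le> r / 2)"
  shows "doubling M d"
  unfolding doubling_def
proof (intro exI[of _ l] ballI allI impI)
  interpret Metric_space M d by fact
  fix x r assume "x \<in> M" "(r::real) > 0"
  from assms(2)[OF this] obtain g :: "'a \<Rightarrow> 'b" and F where
    F: "finite F" "card F \<le> l" "g ` mcball x r \<subseteq> F" and
    g: "\<And>y z. y \<in> mcball x r \<Longrightarrow> z \<in> mcball x r \<Longrightarrow> g y = g z \<Longrightarrow> d y z \<le> r / 2" by metis
  have fin: "finite (g ` mcball x r)" and card: "card (g ` mcball x r) \<le> l"
    using F finite_subset card_mono[OF F(1,3)] by auto
  define c where "c = inv_into (mcball x r) g"
  have c: "c (g y) \<in> mcball x r" "g (c (g y)) = g y" if "y \<in> mcball x r" for y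
    using that by (auto simp: c_def inv_into_into f_inv_into_f simp del: in_mcball)
  show "\<exists>C\<subseteq>M. finite C \<and> card C \<le> l \<and> mcball x r \<subseteq> (\<Union>c\<in>C. mcball c (r / 2))"
  proof (intro exI[of _ "c ` g ` mcball x r"] conjI)
    show "c ` g ` mcball x r \<subseteq> M" using c(1) mcball_subset_mspace by blast
    show "finite (c ` g ` mcball x r)" using fin by simp
    show "card (c ` g ` mcball x r) \<le> l" using card_image_le[OF fin] card by (rule order.trans)
    show "mcball x r \<subseteq> (\<Union>c\<in>c ` g ` mcball x r. mcball c (r / 2))"
    proof
      fix y assume y: "y \<in> mcball x r"
      then have "y \<in> mcball (c (g y)) (r / 2)"
        using c[OF y] g[of "c (g y)" y] mcball_subset_mspace by (auto simp: in_mcball)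
      with y show "y \<in> (\<Union>c\<in>c ` g ` mcball x r. mcball c (r / 2))" by blast
    qed
  qed
qed

lemma laakso_same_sign:
  assumes "y \<in> laakso_space" "z \<in> laakso_space" "0 \<le> y (Suc i) \<longleftrightarrow> 0 \<le> z (Suc i)"
  shows "\<bar>y (Suc i) - z (Suc i)\<bar> \<le> \<bar>y 0 - z 0\<bar>"
proof -
  have "\<bar>y (Suc i)\<bar> = tent i (y 0)" "\<bar>z (Suc i)\<bar> = tent i (z 0)"
    using assms by (auto simp: laakso_space_def)
  then show ?thesis using tent_Lipschitz[of i "y 0" "z 0"] assms(3) by linarith
qed

text \<open>Balls of radius \<open>r < 1\<close> are single points. Let \<open>4 ^ j \<le> r < 4 ^ (j + 1)\<close>. Points of a ball of radius \<open>r\<close> are classified by the time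
  up to \<open>r / 2\<close> (five values) and the signs at the scales \<open>j\<close>, \<open>j + 1\<close> and at the only scale
  \<open>\<ge> j + 2\<close>, if any, that has the beginning or the end of a bump within \<open>r\<close> of the centre. Below scale \<open>j\<close> all coordinates are at
  most \<open>r / 4\<close>; at the remaining scales either the bumps vanish on the whole ball or the sign is
  constant on it. Equal signs suffice, since \<^const>\<open>tent\<close> is 1-Lipschitz in time.\<close>

lemma doubling_laakso: "doubling laakso_space sup_dist"
proof (rule doublingI_classification[where l = 40, OF Metric_space_laakso])
  interpret Metric_space laakso_space sup_dist by (rule Metric_space_laakso)
  fix x r assume x: "x \<in> laakso_space" and r: "(r::real) > 0"
  have ball: "y \<in> laakso_space" "real_of_int \<bar>x i - y i\<bar> \<le> r" "\<bar>x i - y i\<bar> \<le> \<lfloor>r\<rfloor>"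
    if "y \<in> mcball x r" for y i
    using that coord_le_sup_dist[OF x, of y i] by (auto simp: in_mcball le_floor_iff)
  show "\<exists>(g :: _ \<Rightarrow> int \<times> bool \<times> bool \<times> bool) F. finite F \<and> card F \<le> 40 \<and> g ` mcball x r \<subseteq> F \<and>
      (\<forall>y\<in>mcball x r. \<forall>z\<in>mcball x r. g y = g z \<longrightarrow> sup_dist y z \<le> r / 2)"
  proof (cases "r < 1")
    case True
    have "y = x" if "y \<in> mcball x r" for y
    proof
      fix i show "y i = x i" using ball(2)[OF that, of i] True by linarith
    qed
    then have "\<forall>y\<in>mcball x r. \<forall>z\<in>mcball x r. sup_dist y z \<le> r / 2"
      using x r by (metis zero less_eq_real_def half_gt_zero)
    then show ?thesis by (intro exI[of _ "\<lambda>_. (0, True, True, True)"] exI[of _ "{(0, True, True, True)}"]) auto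
  next
    case False
    define R where "R = \<lfloor>r\<rfloor>"
    have R: "R \<ge> 1" "real_of_int R \<le> r" using False by (auto simp: R_def le_floor_iff)
    obtain m where m: "R = int m" using R(1) by (metis nonneg_int_cases order.trans zero_le_one)
    obtain j where "4 ^ j \<le> m" "m < 4 ^ (j + 1)" using ex_power_ivl1[of 4 m] R(1) m by auto
    then have "int (4 ^ j) \<le> R" "R < int (4 ^ (j + 1))" unfolding m of_nat_le_iff of_nat_less_iff by auto
    then have j: "4 ^ j \<le> R" "R < 4 ^ (j + 1)" by simp_all
    define bad where "bad = (\<lambda>i. i \<ge> j + 2 \<and> (\<exists>q. odd q \<and> \<bar>x 0 - q * 4 ^ i\<bar> \<le> R))"
    have half: "2 * R < 4 ^ i" if "i \<ge> j + 2" for i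
    proof -
      have "(4::int) ^ (j + 2) \<le> 4 ^ i" using that by (intro power_increasing) auto
      then show ?thesis using j(2) R by simp
    qed
    have uniq: "i = i'" if "bad i" "bad i'" for i i'
      using that near_odd_multiple_unique half unfolding bad_def by (metis le_antisym)
    \<comment> \<open>An arbitrary scale if no scale is bad.\<close>
    define i0 where "i0 = (SOME i. bad i)"
    have i0: "i = i0" if "bad i" for i
      using that uniq unfolding i0_def by (metis someI)
    define \<tau> where "\<tau> = (\<lambda>y :: nat \<Rightarrow> int. \<lfloor>2 * (real_of_int (y 0 - x 0)) / r\<rfloor>)"
    define nneg where "nneg = (\<lambda>(y :: nat \<Rightarrow> int) i. 0 \<le> y (Suc i))"
    define g where "g = (\<lambda>y. (\<tau> y, nneg y j, nneg y (Suc j), nneg y i0))"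
    have "\<tau> y \<in> {-2..2}" if "y \<in> mcball x r" for y
    proof -
      have "real_of_int (y 0 - x 0) \<le> r" "- r \<le> real_of_int (y 0 - x 0)"
        using ball(2)[OF that, of 0] by linarith+
      then have "2 * real_of_int (y 0 - x 0) / r \<le> 2" "- 2 \<le> 2 * real_of_int (y 0 - x 0) / r"
        using r by (auto simp: field_simps)
      then show ?thesis unfolding \<tau>_def by (auto simp: floor_le_iff le_floor_iff)
    qed
    then have sub: "g ` mcball x r \<subseteq> {-2..2} \<times> UNIV" by (auto simp: g_def simp del: in_mcball)
    have "sup_dist y z \<le> r / 2" if yz: "y \<in> mcball x r" "z \<in> mcball x r" and eq: "g y = g z" for y z
    proof -
      note Y = ball[OF yz(1)] and Z = ball[OF yz(2)]
      have "\<tau> y = \<tau> z" using eq by (simp add: g_def)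
      then have "\<bar>2 * real_of_int (y 0 - x 0) / r - 2 * real_of_int (z 0 - x 0) / r\<bar> < 1"
        unfolding \<tau>_def by linarith
      also have "2 * real_of_int (y 0 - x 0) / r - 2 * real_of_int (z 0 - x 0) / r
          = 2 * real_of_int (y 0 - z 0) / r" by (simp add: diff_divide_distrib[symmetric])
      finally have time: "real_of_int \<bar>y 0 - z 0\<bar> \<le> r / 2"
        using r by (simp add: abs_mult field_simps abs_if split: if_splits)
      have "real_of_int \<bar>y i - z i\<bar> \<le> r / 2" for i
      proof (cases i)
        case 0 then show ?thesis using time by simp
      next
        case (Suc k)
        have abs: "\<bar>x (Suc k)\<bar> = tent k (x 0)" "\<bar>y (Suc k)\<bar> = tent k (y 0)" "\<bar>z (Suc k)\<bar> = tent k (z 0)"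
          using x Y(1) Z(1) by (auto simp: laakso_space_def)
        have ?thesis if "nneg y k = nneg z k"
          using laakso_same_sign[OF Y(1) Z(1), of k] that time unfolding nneg_def Suc by linarith
        moreover have "nneg y k = nneg z k" if "k \<in> {j, Suc j}" using eq that by (auto simp: g_def)
        moreover have "nneg y k = nneg z k" if "bad k" using eq i0[OF that] by (auto simp: g_def)
        moreover have ?thesis if "k < j"
        proof -
          have "(4::int) ^ Suc k \<le> 4 ^ j" using that by (intro power_increasing) auto
          then have "4 * (4::int) ^ k \<le> R" using j(1) by simp
          moreover have "\<bar>y i - z i\<bar> \<le> \<bar>y i\<bar> + \<bar>z i\<bar>" by (rule abs_triangle_ineq4)
          moreover have "\<bar>y i\<bar> \<le> 4 ^ k" "\<bar>z i\<bar> \<le> 4 ^ k"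
            using abs(2,3) tent_le[of k] by (simp_all add: Suc)
          ultimately have "\<bar>y i - z i\<bar> * 2 \<le> R" by simp
          then have "real_of_int (\<bar>y i - z i\<bar> * 2) \<le> real_of_int R" unfolding of_int_le_iff .
          then show ?thesis using R(2) by simp
        qed
        moreover have "nneg y k = nneg z k" if k: "k \<ge> j + 2" "\<not> bad k"
        proof (cases "tent k (x 0) \<le> R")
          case True
          have "tent k (w 0) = 0" if w: "w \<in> mcball x r" for w
          proof (rule ccontr)
            assume "tent k (w 0) \<noteq> 0"
            then have "tent k (w 0) > 0" using tent_nonneg[of k "w 0"] by simp
            from near_odd_multiple[OF True _ this] obtain q where "odd q" "\<bar>x 0 - q * 4 ^ k\<bar> \<le> R"
              using ball(3)[OF w, of 0] unfolding R_def by metis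
            with k show False by (auto simp: bad_def)
          qed
          from this[OF yz(1)] this[OF yz(2)] show ?thesis using abs by (simp add: nneg_def)
        next
          case False
          then show ?thesis using abs Y(3)[of "Suc k"] Z(3)[of "Suc k"] unfolding nneg_def R_def by linarith
        qed
        ultimately show ?thesis by (cases "k < j"; cases "k \<in> {j, Suc j}") auto
      qed
      then show ?thesis using sup_dist_le_iff[OF Y(1) Z(1)] by blast
    qed
    moreover have "card ({-2..2::int} \<times> (UNIV :: (bool \<times> bool \<times> bool) set)) \<le> 40"
      by (simp add: card_cartesian_product card_UNIV_bool UNIV_Times_UNIV[symmetric] del: UNIV_Times_UNIV)
    moreover have "finite ({-2..2::int} \<times> (UNIV :: (bool \<times> bool \<times> bool) set))" by simp
    ultimately show ?thesis using sub by blast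
  qed
qed

section \<open>Trees in doubling spaces\<close>

definition doubling_with :: "nat \<Rightarrow> 'a set \<Rightarrow> ('a \<Rightarrow> 'a \<Rightarrow> real) \<Rightarrow> bool" where
  "doubling_with l M d \<longleftrightarrow> (\<forall>x\<in>M. \<forall>r>0. \<exists>C\<subseteq>M. finite C \<and> card C \<le> l \<and>
     Metric_space.mcball M d x r \<subseteq> (\<Union>c\<in>C. Metric_space.mcball M d c (r / 2)))"

lemma doubling_with_mono: "doubling_with l M d \<Longrightarrow> l \<le> l' \<Longrightarrow> doubling_with l' M d"
  unfolding doubling_with_def by (meson order.trans)

lemma doubling_iterate:
  assumes cov: "doubling_with l M d"
    and "x \<in> M" "r > 0"
  shows "\<exists>C\<subseteq>M. finite C \<and> card C \<le> l ^ k \<and>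
     Metric_space.mcball M d x r \<subseteq> (\<Union>c\<in>C. Metric_space.mcball M d c (r / 2 ^ k))"
proof (induction k)
  case 0
  show ?case using assms(2) by (intro exI[of _ "{x}"]) auto
next
  case (Suc k)
  then obtain C where C: "C \<subseteq> M" "finite C" "card C \<le> l ^ k"
    "Metric_space.mcball M d x r \<subseteq> (\<Union>c\<in>C. Metric_space.mcball M d c (r / 2 ^ k))" by blast
  have "\<forall>c\<in>C. \<exists>C'\<subseteq>M. finite C' \<and> card C' \<le> l \<and>
     Metric_space.mcball M d c (r / 2 ^ k) \<subseteq> (\<Union>c\<in>C'. Metric_space.mcball M d c (r / 2 ^ k / 2))"
    using C(1) assms(3) by (intro ballI cov[unfolded doubling_with_def, rule_format]) auto
  then obtain F where F: "\<And>c. c \<in> C \<Longrightarrow> F c \<subseteq> M \<and> finite (F c) \<and> card (F c) \<le> l \<and>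
     Metric_space.mcball M d c (r / 2 ^ k) \<subseteq> (\<Union>c\<in>F c. Metric_space.mcball M d c (r / 2 ^ k / 2))"
    by metis
  have "card (\<Union>c\<in>C. F c) \<le> (\<Sum>c\<in>C. card (F c))" using C(2) by (rule card_UN_le)
  also have "\<dots> \<le> (\<Sum>c\<in>C. l)" using F by (intro sum_mono) blast
  also have "\<dots> = card C * l" by simp
  also have "\<dots> \<le> l ^ k * l" using C(3) by (rule mult_right_mono) simp
  finally have "card (\<Union>c\<in>C. F c) \<le> l ^ Suc k" by (simp add: mult.commute)
  moreover have "Metric_space.mcball M d x r
      \<subseteq> (\<Union>c\<in>(\<Union>c\<in>C. F c). Metric_space.mcball M d c (r / 2 ^ Suc k))"
  proof
    fix y assume "y \<in> Metric_space.mcball M d x r"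
    then obtain c where c: "c \<in> C" "y \<in> Metric_space.mcball M d c (r / 2 ^ k)" using C(4) by blast
    then obtain c' where "c' \<in> F c" "y \<in> Metric_space.mcball M d c' (r / 2 ^ k / 2)" using F by blast
    then show "y \<in> (\<Union>c\<in>(\<Union>c\<in>C. F c). Metric_space.mcball M d c (r / 2 ^ Suc k))"
      using c(1) by (auto simp: mult.commute)
  qed
  ultimately show ?case using C(2) F by (intro exI[of _ "\<Union>c\<in>C. F c"]) blast
qed

text \<open>Every ball of the iterated covering contains at most one of the separated points.\<close>

lemma separated_card_le:
  assumes "Metric_space M d"
    and cov: "doubling_with l M d"
    and "x \<in> M" "r > 0"
    and A: "A \<subseteq> Metric_space.mcball M d x r"
    and sep: "\<And>a b. a \<in> A \<Longrightarrow> b \<in> A \<Longrightarrow> a \<noteq> b \<Longrightarrow> d a b > 2 * (r / 2 ^ k)"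
  shows "card A \<le> l ^ k"
proof -
  interpret Metric_space M d by fact
  obtain C where C: "finite C" "card C \<le> l ^ k" "mcball x r \<subseteq> (\<Union>c\<in>C. mcball c (r / 2 ^ k))"
    using doubling_iterate[OF cov assms(3,4), where k = k] by blast
  then have "\<forall>a\<in>A. \<exists>c. c \<in> C \<and> a \<in> mcball c (r / 2 ^ k)" using A by blast
  then obtain h where h: "\<And>a. a \<in> A \<Longrightarrow> h a \<in> C \<and> a \<in> mcball (h a) (r / 2 ^ k)" by metis
  have "inj_on h A"
  proof (rule inj_onI, rule ccontr)
    fix a b assume ab: "a \<in> A" "b \<in> A" "h a = h b" "a \<noteq> b"
    have "d a b \<le> d (h a) a + d (h a) b"
      using h[OF ab(1)] h[OF ab(2)] ab(3) triangle[of a "h a" b] commute[of a "h a"] by (auto simp: in_mcball)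
    also have "\<dots> \<le> 2 * (r / 2 ^ k)" using h[OF ab(1)] h[OF ab(2)] ab(3) by (auto simp: in_mcball)
    finally show False using sep[OF ab(1,2,4)] by simp
  qed
  then have "card A \<le> card C" using h C(1) by (intro card_inj_on_le[of h]) auto
  with C(2) show ?thesis by simp
qed

lemma root_walk:
  assumes "length u \<le> n"
  shows "([], u) \<in> tree_edges n ^^ length u \<and> (u, []) \<in> tree_edges n ^^ length u"
  using assms
proof (induction u)
  case (Cons b u)
  then have "(u, b # u) \<in> tree_edges n" "(b # u, u) \<in> tree_edges n"
    by (auto simp: tree_edges_def tree_vertices_def)
  moreover have "([], u) \<in> tree_edges n ^^ length u" "(u, []) \<in> tree_edges n ^^ length u"
    using Cons by simp_all
  ultimately show ?case
    unfolding list.size(4) add_Suc_right add_0_right by (blast intro: relpow_Suc_I relpow_Suc_I2)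
qed simp

lemma tree_dist_root_le: "length u \<le> n \<Longrightarrow> tree_dist n [] u \<le> real (length u)"
  using root_walk[of u n] by (auto simp: tree_dist_def intro: Least_le)

lemma tree_dist_ge_1:
  assumes "u \<in> tree_vertices n" "v \<in> tree_vertices n" "u \<noteq> v"
  shows "tree_dist n u v \<ge> 1"
proof -
  have "(u, v) \<in> tree_edges n ^^ (length u + length v)"
    using assms root_walk[of u n] root_walk[of v n] by (auto simp: tree_vertices_def relpow_add)
  then have "(u, v) \<in> tree_edges n ^^ (LEAST k. (u, v) \<in> tree_edges n ^^ k)" by (rule LeastI)
  then have "(LEAST k. (u, v) \<in> tree_edges n ^^ k) \<noteq> 0"
    using assms(3) by (intro notI) simp
  then show ?thesis by (simp add: tree_dist_def)
qed

text \<open>The leaves of the tree are sent to \<open>2 ^ n\<close> points that are \<open>r\<close>-separated and lie in a ball of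
  radius \<open>D * r * n\<close>. If \<open>2 ^ k > 2 * D * n\<close>, then \<open>k\<close> halvings of the radius leave at most one of
  them in each ball, although only \<open>l ^ k\<close> balls are available.\<close>

lemma tree_distortion_ge:
  assumes "Metric_space M d"
    and cov: "doubling_with l M d"
    and "n > 0" and few: "l ^ k < 2 ^ n"
  shows "ereal (2 ^ k / (2 * real n)) \<le> distortion M d (tree_vertices n) (tree_dist n)"
  unfolding distortion_def
proof (rule Inf_greatest, safe)
  interpret Metric_space M d by fact
  fix D r :: real and f
  assume D: "D > 0" and r: "r > 0" and f: "f \<in> tree_vertices n \<rightarrow> M"
    and bilip: "\<forall>x\<in>tree_vertices n. \<forall>y\<in>tree_vertices n. r * tree_dist n x y \<le> d (f x) (f y) \<and>
          d (f x) (f y) \<le> D * r * tree_dist n x y"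
  define L where "L = {u :: bool list. length u = n}"
  have root: "[] \<in> tree_vertices n" and LV: "L \<subseteq> tree_vertices n"
    by (auto simp: tree_vertices_def L_def)
  have sep: "r \<le> d (f u) (f v)" if "u \<in> L" "v \<in> L" "u \<noteq> v" for u v
  proof -
    have "r * 1 \<le> r * tree_dist n u v" using tree_dist_ge_1[of u n v] that LV r by (intro mult_left_mono) auto
    also have "\<dots> \<le> d (f u) (f v)" using bilip that LV by blast
    finally show ?thesis by simp
  qed
  have inj: "inj_on f L"
  proof (rule inj_onI, rule ccontr)
    fix u v assume uv: "u \<in> L" "v \<in> L" "f u = f v" "u \<noteq> v"
    then have "d (f u) (f v) = 0" using f LV by (metis PiE subsetD zero)
    with sep[OF uv(1,2,4)] r show False by simp
  qed
  have "finite L" "card L = 2 ^ n"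
    using card_lists_length_eq[of "UNIV :: bool set" n] finite_lists_length_eq[of "UNIV :: bool set" n]
    by (simp_all add: L_def)
  then have card: "card (f ` L) = 2 ^ n" using inj by (simp add: card_image)
  have sub: "f ` L \<subseteq> mcball (f []) (D * r * real n)"
  proof safe
    fix u assume u: "u \<in> L"
    then have "d (f []) (f u) \<le> D * r * tree_dist n [] u" using bilip root LV by blast
    also have "\<dots> \<le> D * r * real n"
      using tree_dist_root_le[of u n] u D r by (intro mult_left_mono) (auto simp: L_def)
    finally show "f u \<in> mcball (f []) (D * r * real n)" using f root LV u by (auto simp: in_mcball)
  qed
  have "2 ^ k / (2 * real n) \<le> D"
  proof (rule ccontr)
    assume "\<not> ?thesis"
    then have "D * (2 * real n) < 2 ^ k" using \<open>n > 0\<close> by (simp add: field_simps)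
    then have "r * (D * (2 * real n)) < r * 2 ^ k" using r by simp
    then have "2 * (D * r * real n / 2 ^ k) < r" by (simp add: field_simps)
    then have "card (f ` L) \<le> l ^ k"
      using sep D r \<open>n > 0\<close> f root
      by (intro separated_card_le[OF assms(1) cov _ _ sub]) (auto intro: less_le_trans)
    with few card show False by simp
  qed
  then show "ereal (2 ^ k / (2 * real n)) \<le> ereal D" by simp
qed

lemma doubling_tree_distortion:
  assumes "Metric_space M d" "doubling M d"
  shows "\<exists>\<kappa>>0. \<forall>\<^sub>F n in sequentially.
        ereal (2 powr (\<kappa> * real n)) \<le> distortion M d (tree_vertices n) (tree_dist n)"
proof -
  obtain l where "doubling_with l M d"
    using assms(2) unfolding doubling_def doubling_with_def by blast
  moreover obtain a where "l \<le> 2 ^ a" using less_exp[of l] less_imp_le by blast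
  \<comment> \<open>The successor keeps the exponent positive, also if \<open>l \<le> 1\<close>.\<close>
  ultimately have cov: "doubling_with (2 ^ Suc a) M d" by (auto intro: doubling_with_mono)
  \<comment> \<open>Half of the exponent given by the counting bound; the other half absorbs the factor \<open>2 * n\<close>.\<close>
  define \<kappa> where "\<kappa> = 1 / (2 * real (Suc a))"
  have "\<kappa> > 0" by (simp add: \<kappa>_def)
  have "\<forall>\<^sub>F n in sequentially. 2 powr (\<kappa> * real n) \<le> 2 powr (2 * \<kappa> * real n - 1) / (2 * real n)"
    using \<open>\<kappa> > 0\<close> by real_asymp
  moreover have "\<forall>\<^sub>F n::nat in sequentially. n > 0" by (rule eventually_gt_at_top)
  ultimately have "\<forall>\<^sub>F n in sequentially.
        ereal (2 powr (\<kappa> * real n)) \<le> distortion M d (tree_vertices n) (tree_dist n)"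
  proof eventually_elim
    case (elim n)
    \<comment> \<open>The largest \<open>k\<close> with \<open>(2 ^ Suc a) ^ k < 2 ^ n\<close>.\<close>
    define k where "k = (n - 1) div Suc a"
    have "Suc a * k \<le> n - 1" unfolding k_def by (rule times_div_less_eq_dividend)
    then have ak: "Suc a * k < n" using elim(2) by linarith
    have "(2 ^ Suc a) ^ k < (2::nat) ^ n"
      unfolding power_mult[symmetric] using ak by (intro power_strict_increasing) auto
    then have dist: "ereal (2 ^ k / (2 * real n)) \<le> distortion M d (tree_vertices n) (tree_dist n)"
      using cov elim(2) by (intro tree_distortion_ge[OF assms(1)]) auto
    have "n - 1 < Suc a * (k + 1)"
      unfolding k_def using dividend_less_times_div[of "Suc a" "n - 1"] by simp
    then have "n \<le> Suc a * (k + 1)" by linarith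
    then have "real n \<le> real (Suc a) * (real k + 1)"
      by (metis (mono_tags) of_nat_1 of_nat_add of_nat_le_iff of_nat_mult)
    then have "2 * \<kappa> * real n - 1 \<le> real k" by (simp add: \<kappa>_def field_simps)
    then have "2 powr (2 * \<kappa> * real n - 1) \<le> 2 powr real k" by (intro powr_mono) auto
    also have "\<dots> = 2 ^ k" by (simp add: powr_realpow)
    finally have "2 powr (\<kappa> * real n) \<le> 2 ^ k / (2 * real n)"
      using elim by (meson divide_right_mono order.trans mult_nonneg_nonneg of_nat_0_le_iff zero_le_numeral)
    then show ?case using dist by (metis ereal_less_eq(3) order.trans)
  qed
  with \<open>\<kappa> > 0\<close> show ?thesis by blast
qed

section \<open>Coin tossing chains\<close>

text \<open>In \<^const>\<open>markov_convex_with\<close> the sample points of the chains are real numbers; the outcomes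
  of the coin tosses are encoded in them.\<close>

definition encode_real :: "'a::countable \<Rightarrow> real" where "encode_real x = real (to_nat x)"
definition decode_real :: "real \<Rightarrow> 'a::countable" where "decode_real w = from_nat (nat \<lfloor>w\<rfloor>)"

lemma decode_encode [simp]: "decode_real (encode_real x) = x"
  by (simp add: encode_real_def decode_real_def)

text \<open>\<open>\<phi>\<close> exchanges the parts of \<open>E\<close> inside and outside \<open>B\<close>, so they are equally likely. This is
  the form in which independence of fair coins is used throughout.\<close>

lemma prob_half_by_involution:
  fixes Q :: "'a pmf"
  assumes "map_pmf \<phi> Q = Q"
    and "\<And>x. x \<in> set_pmf Q \<Longrightarrow> E (\<phi> x) \<longleftrightarrow> E x"
    and "\<And>x. x \<in> set_pmf Q \<Longrightarrow> B (\<phi> x) \<longleftrightarrow> \<not> B x"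
  shows "measure Q {x. E x \<and> B x} = measure Q {x. E x} / 2"
proof -
  have "measure Q {x. E x \<and> B x} = measure (map_pmf \<phi> Q) {x. E x \<and> B x}" using assms(1) by simp
  also have "\<dots> = measure Q {x. E (\<phi> x) \<and> B (\<phi> x)}" by (simp add: measure_map_pmf vimage_def)
  also have "\<dots> = measure Q {x. E x \<and> \<not> B x}"
    using assms(2,3) by (intro measure_pmf.finite_measure_eq_AE) (auto simp: AE_measure_pmf_iff)
  finally have "measure Q {x. E x \<and> B x} + measure Q {x. E x \<and> B x}
      = measure Q {x. E x \<and> B x} + measure Q {x. E x \<and> \<not> B x}" by simp
  also have "\<dots> = measure Q ({x. E x \<and> B x} \<union> {x. E x \<and> \<not> B x})"
    by (intro measure_pmf.finite_measure_Union[symmetric]) auto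
  also have "{x. E x \<and> B x} \<union> {x. E x \<and> \<not> B x} = {x. E x}" by blast
  finally show ?thesis by simp
qed

text \<open>Two independent sequences of \<open>T\<close> coin tosses: the first drives the chain, the second drives all
  its continuations. One second sequence is enough because different continuations need not be
  independent of each other.\<close>

definition coin_pairs :: "nat \<Rightarrow> (bool list \<times> bool list) set" where
  "coin_pairs T = {u. length u = T} \<times> {v. length v = T}"

lemma coin_pairs_fin: "finite (coin_pairs T)" "coin_pairs T \<noteq> {}"
proof -
  have "finite {u :: bool list. length u = T}"
    using finite_lists_length_eq[of "UNIV :: bool set" T] by simp
  then show "finite (coin_pairs T)" by (simp add: coin_pairs_def)
  show "coin_pairs T \<noteq> {}" unfolding coin_pairs_def using length_replicate[of T True] by blast
qed

definition coins :: "nat \<Rightarrow> (bool list \<times> bool list) pmf" where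
  "coins T = pmf_of_set (coin_pairs T)"

lemma set_coins [simp]: "set_pmf (coins T) = coin_pairs T"
  by (simp add: coins_def coin_pairs_fin)

definition flip :: "nat \<Rightarrow> bool list \<Rightarrow> bool list" where
  "flip i u = u[i := \<not> u ! i]"

lemma length_flip [simp]: "length (flip i u) = length u"
  by (simp add: flip_def)

lemma nth_flip: "j < length u \<Longrightarrow> flip i u ! j = (if j = i then \<not> u ! j else u ! j)"
  by (auto simp: flip_def)

lemma flip_flip [simp]: "flip i (flip i u) = u"
  by (rule nth_equalityI) (simp_all add: nth_flip)

lemma map_coins_involution:
  assumes "\<And>\<omega>. \<omega> \<in> coin_pairs T \<Longrightarrow> \<phi> \<omega> \<in> coin_pairs T" "\<And>\<omega>. \<phi> (\<phi> \<omega>) = \<omega>"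
  shows "map_pmf \<phi> (coins T) = coins T"
  unfolding coins_def
proof (rule map_pmf_of_set_bij_betw[OF _ coin_pairs_fin(2,1)])
  show "bij_betw \<phi> (coin_pairs T) (coin_pairs T)"
    using assms by (intro bij_betwI[where g = \<phi>]) auto
qed

lemma map_coins_flip:
  "map_pmf (apfst (flip i)) (coins T) = coins T" "map_pmf (apsnd (flip i)) (coins T) = coins T"
  by (auto intro!: map_coins_involution simp: coin_pairs_def)

text \<open>The state at time \<open>t\<close> is the whole history of tosses. The history is constant before time
  \<open>0\<close> and after time \<open>T\<close>.\<close>

definition walk :: "bool list \<Rightarrow> int \<Rightarrow> nat" where
  "walk u t = to_nat (take (nat t) u)"

definition coin_kernel :: "nat \<Rightarrow> int \<Rightarrow> nat \<Rightarrow> nat pmf" where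
  "coin_kernel T t a = (if 0 \<le> t \<and> t < int T
     then map_pmf (\<lambda>b. to_nat ((from_nat a :: bool list) @ [b])) (pmf_of_set UNIV)
     else return_pmf a)"

lemma walk_flip: "s \<le> t \<Longrightarrow> walk (flip (nat t) u) s = walk u s"
  by (simp add: walk_def flip_def nat_mono)

text \<open>Tosses from index \<open>k\<close> on are taken from the second sequence. The definition is by positions,
  and not by \<^const>\<open>take\<close> and \<^const>\<open>drop\<close>, so that the histories agree up to time \<open>k\<close> for
  arbitrary pairs of lists: a continuation agrees with the chain at every sample point, also at
  those of probability zero.\<close>

definition resample :: "int \<Rightarrow> bool list \<times> bool list \<Rightarrow> bool list" where
  "resample k \<omega> = map (\<lambda>i. if int i < k then fst \<omega> ! i else snd \<omega> ! i) [0..<length (fst \<omega>)]"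

lemma length_resample [simp]: "length (resample k \<omega>) = length (fst \<omega>)"
  by (simp add: resample_def)

lemma nth_resample: "i < length (fst \<omega>) \<Longrightarrow>
    resample k \<omega> ! i = (if int i < k then fst \<omega> ! i else snd \<omega> ! i)"
  by (simp add: resample_def)

lemma walk_resample: "t \<le> k \<Longrightarrow> walk (resample k \<omega>) t = walk (fst \<omega>) t"
  unfolding walk_def by (intro arg_cong[of _ _ to_nat] nth_equalityI) (auto simp: nth_resample)

lemma resample_flip:
  assumes "\<omega> \<in> coin_pairs T" "k \<le> t" "0 \<le> t"
  shows "resample k (apsnd (flip (nat t)) \<omega>) = flip (nat t) (resample k \<omega>)"
  using assms by (intro nth_equalityI) (auto simp: nth_resample nth_flip coin_pairs_def)

text \<open>The common core of the Markov property and of the law of a continuation: if an event \<open>E\<close>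
  fixes the history \<open>a\<close> of \<open>z\<close> at time \<open>t\<close> and is invariant under a measure preserving
  \<open>\<phi>\<close> that flips the next toss of \<open>z\<close>, then on \<open>E\<close> the next toss is fair.\<close>

lemma coin_transition:
  assumes len: "\<And>\<omega>. \<omega> \<in> coin_pairs T \<Longrightarrow> length (z \<omega>) = T"
    and det: "\<And>\<omega>. \<omega> \<in> coin_pairs T \<Longrightarrow> E \<omega> \<Longrightarrow> walk (z \<omega>) t = a"
    and flip: "0 \<le> t \<Longrightarrow> t < int T \<Longrightarrow> map_pmf \<phi> (coins T) = coins T"
      "\<And>\<omega>. 0 \<le> t \<Longrightarrow> t < int T \<Longrightarrow> \<omega> \<in> coin_pairs T \<Longrightarrow> z (\<phi> \<omega>) = flip (nat t) (z \<omega>)"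
      "\<And>\<omega>. 0 \<le> t \<Longrightarrow> t < int T \<Longrightarrow> \<omega> \<in> coin_pairs T \<Longrightarrow> E (\<phi> \<omega>) \<longleftrightarrow> E \<omega>"
  shows "measure (coins T) {\<omega>. E \<omega> \<and> walk (z \<omega>) (t + 1) = c}
    = measure (coins T) {\<omega>. E \<omega>} * pmf (coin_kernel T t a) c"
proof (cases "0 \<le> t \<and> t < int T")
  case False
  have "walk (z \<omega>) (t + 1) = a" if "\<omega> \<in> coin_pairs T" "E \<omega>" for \<omega>
    using det[OF that] len[OF that(1)] False by (auto simp: walk_def)
  then have "measure (coins T) {\<omega>. E \<omega> \<and> walk (z \<omega>) (t + 1) = c}
      = measure (coins T) (if a = c then {\<omega>. E \<omega>} else {})"
    by (intro measure_pmf.finite_measure_eq_AE) (auto simp: AE_measure_pmf_iff)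
  with False show ?thesis by (auto simp: coin_kernel_def indicator_def)
next
  case True
  define h :: "bool list" where "h = from_nat a"
  have step: "walk (z \<omega>) (t + 1) = to_nat (h @ [z \<omega> ! nat t])" if "\<omega> \<in> coin_pairs T" "E \<omega>" for \<omega>
  proof -
    have "h = take (nat t) (z \<omega>)" using det[OF that] by (auto simp: h_def walk_def)
    moreover have "nat (t + 1) = Suc (nat t)" using True by (simp add: nat_add_distrib)
    moreover have "nat t < length (z \<omega>)" using True len[OF that(1)] by linarith
    ultimately show ?thesis by (simp add: walk_def take_Suc_conv_app_nth)
  qed
  have kernel: "coin_kernel T t a = map_pmf (\<lambda>b. to_nat (h @ [b])) (pmf_of_set UNIV)"
    using True by (simp add: coin_kernel_def h_def)
  have inj: "inj (\<lambda>b. to_nat (h @ [b]))" by (auto intro: injI)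
  show ?thesis
  proof (cases "\<exists>b. c = to_nat (h @ [b])")
    case True': True
    then obtain b where b: "c = to_nat (h @ [b])" ..
    have "measure (coins T) {\<omega>. E \<omega> \<and> walk (z \<omega>) (t + 1) = c}
        = measure (coins T) {\<omega>. E \<omega> \<and> z \<omega> ! nat t = b}"
      using step b by (intro measure_pmf.finite_measure_eq_AE) (auto simp: AE_measure_pmf_iff)
    also have "\<dots> = measure (coins T) {\<omega>. E \<omega>} * (1 / 2)"
      unfolding times_divide_eq_right mult_1_right using True flip len by (intro prob_half_by_involution[where \<phi> = \<phi>]) (auto simp: nth_flip)
    also have "1 / 2 = pmf (coin_kernel T t a) c"
      unfolding kernel b by (subst pmf_map_inj'[OF inj]) (simp add: card_UNIV_bool)
    finally show ?thesis .
  next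
    case False
    then have "measure (coins T) {\<omega>. E \<omega> \<and> walk (z \<omega>) (t + 1) = c} = measure (coins T) {}"
      using step by (intro measure_pmf.finite_measure_eq_AE) (auto simp: AE_measure_pmf_iff)
    moreover have "pmf (coin_kernel T t a) c = 0"
      using False unfolding kernel by (auto simp: pmf_eq_0_set_pmf)
    ultimately show ?thesis by simp
  qed
qed

definition coin_space :: "nat \<Rightarrow> real measure" where
  "coin_space T = measure_pmf (map_pmf encode_real (coins T))"

lemma measure_coin_space: "measure (coin_space T) {w \<in> space (coin_space T). A (decode_real w)}
    = measure (coins T) {\<omega>. A \<omega>}"
  by (simp add: coin_space_def measure_map_pmf vimage_def)

lemma markov_chain_coin:
  "markov_chain (coin_space T) (coin_kernel T) (\<lambda>t w. walk (fst (decode_real w :: bool list \<times> bool list)) t)"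
  unfolding markov_chain_def
proof (intro conjI allI)
  show "prob_space (coin_space T)" unfolding coin_space_def by (rule measure_pmf.prob_space_axioms)
  show "(\<lambda>w. walk (fst (decode_real w :: bool list \<times> bool list)) t) \<in> coin_space T \<rightarrow>\<^sub>M count_space UNIV" for t
    by (simp add: coin_space_def)
  fix t :: int and x :: "int \<Rightarrow> nat" and n :: nat
  have *: "{t - int n..t + 1} = insert (t + 1) {t - int n..t}" by auto
  have "measure (coins T) {\<omega>. (\<forall>s\<in>{t - int n..t}. walk (fst \<omega>) s = x s) \<and> walk (fst \<omega>) (t + 1) = x (t + 1)}
      = measure (coins T) {\<omega>. \<forall>s\<in>{t - int n..t}. walk (fst \<omega>) s = x s} * pmf (coin_kernel T t (x t)) (x (t + 1))"
    by (rule coin_transition[where \<phi> = "apfst (flip (nat t))"])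
      (simp_all add: map_coins_flip coin_pairs_def mem_Times_iff walk_flip)
  then show "measure (coin_space T) {w \<in> space (coin_space T). \<forall>s\<in>{t - int n..t + 1}. walk (fst (decode_real w :: bool list \<times> bool list)) s = x s}
      = measure (coin_space T) {w \<in> space (coin_space T). \<forall>s\<in>{t - int n..t}. walk (fst (decode_real w :: bool list \<times> bool list)) s = x s}
        * pmf (coin_kernel T t (x t)) (x (t + 1))"
    unfolding * measure_coin_space[where A = "\<lambda>\<omega>. \<forall>s\<in>_. walk (fst \<omega>) s = x s"]
    by (simp add: conj_commute)
qed

lemma independent_continuation_coin:
  "independent_continuation (coin_space T) (coin_kernel T)
     (\<lambda>t w. walk (fst (decode_real w :: bool list \<times> bool list)) t) k
     (\<lambda>t w. walk (resample k (decode_real w)) t)"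
  unfolding independent_continuation_def
proof (intro conjI allI impI ballI)
  show "(\<lambda>w. walk (resample k (decode_real w)) t) \<in> coin_space T \<rightarrow>\<^sub>M count_space UNIV" for t
    by (simp add: coin_space_def)
  show "walk (resample k (decode_real w)) t = walk (fst (decode_real w :: bool list \<times> bool list)) t" if "t \<le> k" for t w
    using that by (rule walk_resample)
  fix t :: int and x y :: "int \<Rightarrow> nat" and n :: nat
  assume t: "k \<le> t"
  have *: "{k..t + 1} = insert (t + 1) {k..t}" using t by auto
  define E where "E = (\<lambda>\<omega>. (\<forall>s\<in>{k - int n..k + int n}. walk (fst \<omega>) s = x s) \<and>
      (\<forall>s\<in>{k..t}. walk (resample k \<omega>) s = y s))"
  have "measure (coins T) {\<omega>. E \<omega> \<and> walk (resample k \<omega>) (t + 1) = y (t + 1)}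
      = measure (coins T) {\<omega>. E \<omega>} * pmf (coin_kernel T t (y t)) (y (t + 1))"
    using t by (intro coin_transition[where \<phi> = "apsnd (flip (nat t))"])
      (simp_all add: E_def map_coins_flip coin_pairs_def mem_Times_iff resample_flip walk_flip)
  moreover have "E \<omega> \<and> walk (resample k \<omega>) (t + 1) = y (t + 1) \<longleftrightarrow>
      (\<forall>s\<in>{k - int n..k + int n}. walk (fst \<omega>) s = x s) \<and>
      (\<forall>s\<in>{k..t + 1}. walk (resample k \<omega>) s = y s)" for \<omega>
    unfolding * E_def by auto
  ultimately show "measure (coin_space T) {w \<in> space (coin_space T).
         (\<forall>s\<in>{k - int n..k + int n}. walk (fst (decode_real w :: bool list \<times> bool list)) s = x s) \<and>
         (\<forall>s\<in>{k..t + 1}. walk (resample k (decode_real w)) s = y s)}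
      = measure (coin_space T) {w \<in> space (coin_space T).
         (\<forall>s\<in>{k - int n..k + int n}. walk (fst (decode_real w :: bool list \<times> bool list)) s = x s) \<and>
         (\<forall>s\<in>{k..t}. walk (resample k (decode_real w)) s = y s)} * pmf (coin_kernel T t (y t)) (y (t + 1))"
    unfolding measure_coin_space[where A = "\<lambda>\<omega>. (\<forall>s\<in>_. walk (fst \<omega>) s = x s) \<and>
         (\<forall>s\<in>_. walk (resample k \<omega>) s = y s)"]
    by (simp add: E_def)
qed

section \<open>Failure of Markov convexity\<close>

text \<open>The start of the bump of scale \<open>i\<close> in the period containing \<open>t\<close>; a bump whose two sides are
  distinguished by signs is called a bubble.\<close>

definition bubble_start :: "nat \<Rightarrow> nat \<Rightarrow> nat" where
  "bubble_start i t = t div 4 ^ Suc i * 4 ^ Suc i + 4 ^ i"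

text \<open>The walk chooses a side of a bubble by the toss made on entering it. If the walk has not
  entered the bubble of this period, the index of the toss may be out of range, but then the bump
  is zero and the value of the toss does not matter.\<close>

definition laakso_point :: "bool list \<Rightarrow> nat \<Rightarrow> int" where
  "laakso_point u n = (case n of 0 \<Rightarrow> int (length u)
     | Suc i \<Rightarrow> (if u ! bubble_start i (length u) then 1 else - 1) * tent i (int (length u)))"

lemma laakso_point_mem: "laakso_point u \<in> laakso_space"
  by (auto simp: laakso_space_def laakso_point_def abs_mult tent_nonneg)

lemma tent_nat: "tent i (int t) = max 0 (4 ^ i - \<bar>int (t mod 4 ^ Suc i) - 2 * 4 ^ i\<bar>)"
  by (simp add: tent_def zmod_int)

lemma tent_pos_nat:
  assumes "tent i (int t) > 0"
  shows "4 ^ i < t mod 4 ^ Suc i"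
proof -
  have "0 < (4::int) ^ i - \<bar>int (t mod 4 ^ Suc i) - 2 * 4 ^ i\<bar>"
    using assms unfolding tent_nat less_max_iff_disj by blast
  then have "(4::int) ^ i < int (t mod 4 ^ Suc i)" by linarith
  then have "int (4 ^ i) < int (t mod 4 ^ Suc i)" by (simp only: of_nat_power of_nat_numeral)
  then show ?thesis unfolding of_nat_less_iff .
qed

lemma bubble_start_less:
  assumes "tent i (int t) > 0"
  shows "bubble_start i t < t"
  unfolding bubble_start_def
  using tent_pos_nat[OF assms] div_mult_mod_eq[of t "4 ^ Suc i"] by linarith

text \<open>The sign of a nonzero coordinate persists along the walk, because a bump vanishes at the
  beginning of each period.\<close>

lemma bubble_start_Suc:
  assumes "tent i (int (Suc t)) > 0"
  shows "bubble_start i (Suc t) = bubble_start i t"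
proof -
  have "Suc t mod 4 ^ Suc i \<noteq> 0" using tent_pos_nat[OF assms] by linarith
  then show ?thesis by (simp add: bubble_start_def div_Suc)
qed

lemma laakso_point_step: "\<bar>laakso_point (u @ [b]) n - laakso_point u n\<bar> \<le> 1"
proof (cases n)
  case 0
  then show ?thesis by (simp add: laakso_point_def)
next
  case (Suc i)
  define t where "t = length u"
  have step: "\<bar>tent i (int (Suc t)) - tent i (int t)\<bar> \<le> 1"
    using tent_Lipschitz[of i "int (Suc t)" "int t"] by simp
  then have step': "\<bar>tent i (int t) - tent i (int (Suc t))\<bar> \<le> 1" by linarith
  show ?thesis
  proof (cases "tent i (int t) > 0 \<and> tent i (int (Suc t)) > 0")
    case True
    then have "(u @ [b]) ! bubble_start i (Suc t) = u ! bubble_start i t"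
      using bubble_start_Suc[of i t] bubble_start_less[of i t] by (simp add: nth_append t_def)
    then show ?thesis using step step' by (simp add: Suc laakso_point_def t_def)
  next
    case False
    then have "tent i (int t) = 0 \<or> tent i (int (Suc t)) = 0"
      using tent_nonneg[of i "int t"] tent_nonneg[of i "int (Suc t)"] by linarith
    then show ?thesis using step step' by (auto simp: Suc laakso_point_def t_def)
  qed
qed

lemma sup_dist_walk_step:
  "sup_dist (laakso_point (take (nat t) u)) (laakso_point (take (nat (t - 1)) u)) \<le> 1"
proof (cases "0 < t \<and> nat t \<le> length u")
  case True
  then obtain m where m: "nat t = Suc m" "nat (t - 1) = m" "m < length u"
    by (cases "nat t") (auto simp: nat_diff_distrib)
  then show ?thesis
    using laakso_point_step[of "take m u" "u ! m"]
    by (simp add: sup_dist_le_iff laakso_point_mem take_Suc_conv_app_nth) (metis of_int_abs of_int_1 of_int_diff of_int_le_iff)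
next
  case False
  then have "take (nat t) u = take (nat (t - 1)) u" by (cases "0 < t") auto
  then show ?thesis by (simp add: sup_dist_le_iff laakso_point_mem)
qed

lemma sup_dist_bubble:
  assumes "length u = t" "length v = t" "u ! bubble_start i t \<noteq> v ! bubble_start i t"
  shows "2 * real_of_int (tent i (int t)) \<le> sup_dist (laakso_point u) (laakso_point v)"
proof -
  have "2 * tent i (int t) = \<bar>laakso_point u (Suc i) - laakso_point v (Suc i)\<bar>"
    using assms tent_nonneg[of i "int t"] by (auto simp: laakso_point_def)
  then have "2 * real_of_int (tent i (int t)) = real_of_int \<bar>laakso_point u (Suc i) - laakso_point v (Suc i)\<bar>"
    by (metis of_int_mult of_int_numeral)
  also have "\<dots> \<le> sup_dist (laakso_point u) (laakso_point v)"
    by (intro coord_le_sup_dist laakso_point_mem)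
  finally show ?thesis .
qed

text \<open>If the current bubble was entered at most \<open>4 ^ i\<close> steps ago, the continuation has tossed
  for its side anew, so that the two walks are on opposite sides with probability one half.\<close>

lemma resample_distance_moment:
  assumes t: "t \<le> T" and a: "t - 4 ^ i \<le> bubble_start i t" "4 ^ i \<le> t" "bubble_start i t < t"
    and half: "4 ^ i \<le> 2 * tent i (int t)" and p: "p > 0"
  shows "ennreal (((4 ^ i) powr p) / 2) \<le> (\<integral>\<^sup>+\<omega>. ennreal (sup_dist
      (laakso_point (take t (fst \<omega>))) (laakso_point (take t (resample (int t - 4 ^ i) \<omega>))) powr p)
        \<partial>coins T)" (is "_ \<le> (\<integral>\<^sup>+\<omega>. ?f \<omega> \<partial>_)")
proof -
  define b where "b = bubble_start i t"
  define B where "B = {\<omega>. fst \<omega> ! b \<noteq> (snd \<omega> :: bool list) ! b}"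
  have "measure (coins T) {\<omega>. True \<and> fst \<omega> ! b \<noteq> snd \<omega> ! b} = measure (coins T) {\<omega>. True} / 2"
    using a(3) t by (intro prob_half_by_involution[where \<phi> = "apfst (flip b)"] map_coins_flip)
      (auto simp: coin_pairs_def nth_flip b_def)
  then have "measure (coins T) B = 1 / 2" by (simp add: B_def)
  then have prob: "emeasure (coins T) B = ennreal (1 / 2)"
    by (simp only: measure_pmf.emeasure_eq_measure)
  have "ennreal (((4 ^ i) powr p) / 2) = ennreal ((4 ^ i) powr p) * ennreal (1 / 2)"
    by (subst ennreal_mult[symmetric]) auto
  also have "\<dots> = (\<integral>\<^sup>+\<omega>. ennreal ((4 ^ i) powr p) * indicator B \<omega> \<partial>coins T)"
    by (simp add: nn_integral_cmult_indicator prob)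
  also have "\<dots> \<le> (\<integral>\<^sup>+\<omega>. ?f \<omega> \<partial>coins T)"
  proof (rule nn_integral_mono_AE, unfold AE_measure_pmf_iff, intro ballI)
    fix \<omega> assume "\<omega> \<in> set_pmf (coins T)"
    then have len: "length (fst \<omega>) = T" "length (snd \<omega>) = T" by (auto simp: coin_pairs_def)
    show "ennreal ((4 ^ i) powr p) * indicator B \<omega> \<le> ?f \<omega>"
    proof (cases "\<omega> \<in> B")
      case True
      have "int (t - 4 ^ i) \<le> int b" using a(1) by (simp add: b_def)
      then have "\<not> int b < int t - 4 ^ i" using a(2) by (simp add: of_nat_diff)
      then have "take t (fst \<omega>) ! b \<noteq> take t (resample (int t - 4 ^ i) \<omega>) ! b"
        using True a(3) t len by (simp add: B_def nth_resample b_def)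
      then have "2 * real_of_int (tent i (int t)) \<le> sup_dist (laakso_point (take t (fst \<omega>)))
          (laakso_point (take t (resample (int t - 4 ^ i) \<omega>)))"
        using t len unfolding b_def by (intro sup_dist_bubble) auto
      moreover have "4 ^ i \<le> 2 * real_of_int (tent i (int t))"
        using half by (metis (mono_tags) of_int_le_iff of_int_mult of_int_numeral of_int_power)
      ultimately have "(4 ^ i) powr p \<le> sup_dist (laakso_point (take t (fst \<omega>)))
          (laakso_point (take t (resample (int t - 4 ^ i) \<omega>))) powr p"
        using p by (intro powr_mono2) auto
      then show ?thesis using True by (simp add: ennreal_leI)
    qed simp
  qed
  finally show ?thesis .
qed

text \<open>The times in the second half of the rising slope of a bump of scale \<open>j + 1\<close>, counted backwards
  from the top: the bump is at least half as high as its maximum, and it began at most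
  \<open>4 ^ (j + 1)\<close> steps ago. They form one eighth of all times before \<open>4 ^ (n + 1)\<close>.\<close>

definition branching_times :: "nat \<Rightarrow> nat \<Rightarrow> nat set" where
  "branching_times n j = (\<lambda>(q, r). q * 4 ^ (j + 2) + (2 * 4 ^ Suc j - r)) ` ({..<4 ^ (n - 1 - j)} \<times> {..<2 * 4 ^ j})"

lemma card_branching_times:
  assumes "j < n"
  shows "card (branching_times n j) * 2 = 4 ^ n"
proof -
  have "inj_on (\<lambda>(q, r). q * 4 ^ (j + 2) + (2 * 4 ^ Suc j - r)) ({..<4 ^ (n - 1 - j)} \<times> {..<2 * 4 ^ j :: nat})"
  proof (rule inj_onI)
    fix a b assume ab: "a \<in> {..<4 ^ (n - 1 - j)} \<times> {..<2 * 4 ^ j :: nat}"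
      "b \<in> {..<4 ^ (n - 1 - j)} \<times> {..<2 * 4 ^ j :: nat}"
      "(case a of (q, r) \<Rightarrow> q * 4 ^ (j + 2) + (2 * 4 ^ Suc j - r))
        = (case b of (q, r) \<Rightarrow> q * 4 ^ (j + 2) + (2 * 4 ^ Suc j - r))"
    obtain q r q' r' where eqs: "a = (q, r)" "b = (q', r')" by (metis surj_pair)
    have r: "r < 2 * 4 ^ j" "r' < 2 * 4 ^ j"
      and eq: "q * 4 ^ (j + 2) + (2 * 4 ^ Suc j - r) = q' * 4 ^ (j + 2) + (2 * 4 ^ Suc j - r')"
      using ab by (simp_all add: eqs)
    have lt: "2 * 4 ^ Suc j - s < (4::nat) ^ (j + 2)" for s by (rule le_less_trans[OF diff_le_self]) simp
    have "(q * 4 ^ (j + 2) + (2 * 4 ^ Suc j - s)) div 4 ^ (j + 2) = q" for q s :: nat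
      using lt[of s] by (subst div_mult_self3) auto
    with eq have "q = q'" by metis
    then show "a = b" using eq r by (simp add: eqs)
  qed
  then have "card (branching_times n j) = 4 ^ (n - 1 - j) * (2 * 4 ^ j)"
    unfolding branching_times_def by (simp add: card_image card_cartesian_product)
  then have "card (branching_times n j) * 2 = 4 ^ (n - 1 - j) * 4 ^ Suc j" by simp
  also have "\<dots> = 4 ^ n" unfolding power_add[symmetric] using assms by simp
  finally show ?thesis .
qed

text \<open>These are the hypotheses of \<open>resample_distance_moment\<close> at scale \<open>j + 1\<close> and horizon
  \<open>4 ^ (n + 1)\<close>.\<close>

lemma branching_times_props:
  assumes j: "j < n" and t: "t \<in> branching_times n j"
  shows "t \<le> 4 ^ (n + 1)" "t - 4 ^ Suc j \<le> bubble_start (Suc j) t" "4 ^ Suc j \<le> t"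
    "bubble_start (Suc j) t < t" "4 ^ Suc j \<le> 2 * tent (Suc j) (int t)"
proof -
  obtain q r where qr: "q < 4 ^ (n - 1 - j)" "r < 2 * 4 ^ j" and t: "t = q * 4 ^ (j + 2) + (2 * 4 ^ Suc j - r)"
    using t by (auto simp: branching_times_def)
  have lt: "2 * 4 ^ Suc j - r < 4 ^ (j + 2)" by (rule le_less_trans[OF diff_le_self]) simp
  have d: "t div 4 ^ Suc (Suc j) = q" and m: "t mod 4 ^ Suc (Suc j) = 2 * 4 ^ Suc j - r"
    using lt unfolding t by auto
  have b: "bubble_start (Suc j) t = q * 4 ^ (j + 2) + 4 ^ Suc j"
    unfolding bubble_start_def d by simp
  show "t - 4 ^ Suc j \<le> bubble_start (Suc j) t" "4 ^ Suc j \<le> t" "bubble_start (Suc j) t < t"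
    unfolding b unfolding t using qr(2) by auto
  have "int (2 * 4 ^ Suc j - r) - 2 * 4 ^ Suc j = - int r" using qr(2) by (subst of_nat_diff) auto
  moreover have "int r < int (2 * 4 ^ j)" using qr(2) unfolding of_nat_less_iff .
  ultimately show "4 ^ Suc j \<le> 2 * tent (Suc j) (int t)"
    unfolding tent_nat m by (simp only: abs_minus_cancel) (simp add: max_def)
  have "t \<le> Suc q * 4 ^ (j + 2)" using lt unfolding t by simp
  also have "\<dots> \<le> 4 ^ (n - 1 - j) * 4 ^ (j + 2)" using qr(1) by (intro mult_right_mono) auto
  also have "\<dots> = 4 ^ (n + 1)" unfolding power_add[symmetric] using j by simp
  finally show "t \<le> 4 ^ (n + 1)" .
qed

lemma sum_le_infsum_ennreal:
  fixes f :: "'a \<Rightarrow> ennreal"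
  assumes "finite B"
  shows "sum f B \<le> (\<Sum>\<^sub>\<infinity>x. f x)"
  using assms by (subst nonneg_infsum_complete) (auto intro: SUP_upper)

definition history_point :: "nat \<Rightarrow> nat \<Rightarrow> int" where
  "history_point a = laakso_point (from_nat a)"

lemma history_point_walk: "history_point (walk u t) = laakso_point (take (nat t) u)"
  by (simp add: history_point_def walk_def)

text \<open>The walk moves by at most one per step, and only between the times \<open>0\<close> and \<open>T\<close>.\<close>

lemma coin_speed_sum:
  assumes "p > 0"
  shows "(\<Sum>\<^sub>\<infinity>t::int. \<integral>\<^sup>+\<omega>. ennreal (sup_dist (history_point (walk (fst \<omega>) t))
      (history_point (walk (fst \<omega>) (t - 1))) powr p) \<partial>coins T) \<le> ennreal (real T)"
    (is "infsum ?g UNIV \<le> _")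
proof -
  have "?g t = 0" if "t \<notin> {1..int T}" for t
  proof -
    have "take (nat t) (fst \<omega>) = take (nat (t - 1)) (fst \<omega>)" if "\<omega> \<in> coin_pairs T" for \<omega>
      using \<open>t \<notin> {1..int T}\<close> that by (cases "t \<le> 0") (auto simp: coin_pairs_def)
    then have "?g t = (\<integral>\<^sup>+\<omega>. 0 \<partial>coins T)"
      by (intro nn_integral_cong_AE) (auto simp: AE_measure_pmf_iff history_point_walk
          Metric_space.zero[OF Metric_space_laakso] laakso_point_mem)
    then show ?thesis by simp
  qed
  then have "infsum ?g UNIV = infsum ?g {1..int T}"
    by (intro infsum_cong_neutral) auto
  also have "\<dots> = (\<Sum>t\<in>{1..int T}. ?g t)" by simp
  also have "\<dots> \<le> (\<Sum>t\<in>{1..int T}. 1)"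
  proof (rule sum_mono)
    fix t
    have "sup_dist (history_point (walk u t)) (history_point (walk u (t - 1))) powr p \<le> 1 powr p" for u
      using assms sup_dist_walk_step[of t u] Metric_space.nonneg[OF Metric_space_laakso]
      by (intro powr_mono2) (auto simp: history_point_walk)
    then have "?g t \<le> (\<integral>\<^sup>+\<omega>. ennreal 1 \<partial>coins T)"
      by (intro nn_integral_mono ennreal_leI) simp
    then show "?g t \<le> 1" by (simp add: measure_pmf.emeasure_space_1)
  qed
  also have "\<dots> = ennreal (real T)" by (simp add: ennreal_of_nat_eq_real_of_nat)
  finally show ?thesis .
qed

text \<open>Only the even indices \<open>k = 2 * (j + 1)\<close> with \<open>j < n\<close> are used, for which \<open>2 ^ k\<close> is the height
  \<open>4 ^ (j + 1)\<close> of the bumps of scale \<open>j + 1\<close>. Each of them contributes at least \<open>4 ^ n / 4\<close>: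
  there are \<open>4 ^ n / 2\<close> branching times, and at each of them the normalised moment is at least
  \<open>1 / 2\<close>.\<close>

lemma coin_branching_sum:
  assumes "p > 0"
  shows "ennreal (real n * 4 ^ n / 4) \<le> (\<Sum>\<^sub>\<infinity>k::nat. \<Sum>\<^sub>\<infinity>t::int.
     (\<integral>\<^sup>+\<omega>. ennreal (sup_dist (history_point (walk (fst \<omega>) t))
        (history_point (walk (resample (t - 2 ^ k) \<omega>) t)) powr p) \<partial>coins (4 ^ (n + 1)))
       / ennreal (2 powr (real k * p)))"
    (is "_ \<le> (\<Sum>\<^sub>\<infinity>k. \<Sum>\<^sub>\<infinity>t. ?h k t / ?c k)")
proof -
  have term_ge: "ennreal (1 / 2) \<le> ?h (2 * Suc j) (int t) / ?c (2 * Suc j)"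
    if j: "j < n" and t: "t \<in> branching_times n j" for j t
  proof -
    have k: "(2::int) ^ (2 * Suc j) = 4 ^ Suc j" by (subst power_mult) simp
    have "2 powr (real (2 * Suc j) * p) = (2 powr real (2 * Suc j)) powr p" by (simp add: powr_powr)
    also have "2 powr real (2 * Suc j) = (2::real) ^ (2 * Suc j)" by (rule powr_realpow) simp
    also have "\<dots> = 4 ^ Suc j" by (subst power_mult) simp
    finally have c: "2 powr (real (2 * Suc j) * p) = (4 ^ Suc j) powr p" .
    have "ennreal (1 / 2) = ennreal ((4 ^ Suc j) powr p / 2) / ?c (2 * Suc j)"
      unfolding c by (subst divide_ennreal) auto
    also have "\<dots> \<le> ?h (2 * Suc j) (int t) / ?c (2 * Suc j)"
      unfolding k history_point_walk nat_int
      by (intro divide_right_mono_ennreal resample_distance_moment branching_times_props[OF j t] assms)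
    finally show ?thesis .
  qed
  have level: "ennreal (4 ^ n / 4) \<le> (\<Sum>\<^sub>\<infinity>t. ?h (2 * Suc j) t / ?c (2 * Suc j))" if j: "j < n" for j
  proof -
    have "real (card (branching_times n j)) * 2 = 4 ^ n"
      using card_branching_times[OF j] by (metis of_nat_mult of_nat_numeral of_nat_power)
    then have "ennreal (4 ^ n / 4) = ennreal (real (card (branching_times n j)) * (1 / 2))" by simp
    also have "\<dots> = of_nat (card (branching_times n j)) * ennreal (1 / 2)"
      by (subst ennreal_mult) (auto simp: ennreal_of_nat_eq_real_of_nat)
    also have "\<dots> = (\<Sum>t\<in>branching_times n j. ennreal (1 / 2))" by simp
    also have "\<dots> \<le> (\<Sum>t\<in>branching_times n j. ?h (2 * Suc j) (int t) / ?c (2 * Suc j))"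
      using term_ge[OF j] by (rule sum_mono)
    also have "\<dots> = (\<Sum>t\<in>int ` branching_times n j. ?h (2 * Suc j) t / ?c (2 * Suc j))"
      by (subst sum.reindex) auto
    also have "\<dots> \<le> (\<Sum>\<^sub>\<infinity>t. ?h (2 * Suc j) t / ?c (2 * Suc j))"
      by (rule sum_le_infsum_ennreal) (auto simp: branching_times_def)
    finally show ?thesis .
  qed
  have "ennreal (real n * 4 ^ n / 4) = of_nat n * ennreal (4 ^ n / 4)"
    by (subst ennreal_of_nat_eq_real_of_nat, subst ennreal_mult[symmetric]) auto
  also have "\<dots> = (\<Sum>j<n. ennreal (4 ^ n / 4))" by simp
  also have "\<dots> \<le> (\<Sum>j<n. \<Sum>\<^sub>\<infinity>t. ?h (2 * Suc j) t / ?c (2 * Suc j))"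
    using level by (intro sum_mono) simp
  also have "\<dots> = (\<Sum>k\<in>(\<lambda>j. 2 * Suc j) ` {..<n}. \<Sum>\<^sub>\<infinity>t. ?h k t / ?c k)"
    by (subst sum.reindex) (auto intro: inj_onI)
  also have "\<dots> \<le> (\<Sum>\<^sub>\<infinity>k. \<Sum>\<^sub>\<infinity>t. ?h k t / ?c k)"
    by (rule sum_le_infsum_ennreal) simp
  finally show ?thesis .
qed

text \<open>All scales up to \<open>n\<close> contribute the same positive multiple of the horizon \<open>T\<close>, so the
  left-hand side of the Markov convexity inequality grows like \<open>n * T\<close> and the right-hand side only
  like \<open>T\<close>.\<close>

lemma not_markov_convex_laakso:
  assumes p: "p > 0"
  shows "\<not> markov_convex laakso_space sup_dist p"
proof
  assume "markov_convex laakso_space sup_dist p"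
  then obtain C where C: "markov_convex_with laakso_space sup_dist p C"
    unfolding markov_convex_def by blast
  obtain n where n: "16 * C powr p < real n" using reals_Archimedean2 by blast
  define T :: nat where "T = 4 ^ (n + 1)"
  have f: "history_point \<in> UNIV \<rightarrow> laakso_space" by (simp add: history_point_def laakso_point_mem)
  note ineq = C[unfolded markov_convex_with_def, rule_format,
      OF f markov_chain_coin independent_continuation_coin, of T,
      unfolded coin_space_def nn_integral_map_pmf decode_encode]
  have "ennreal (real n * 4 ^ n / 4) \<le> ennreal (C powr p) * ennreal (real T)"
    by (rule order.trans[OF order.trans[OF coin_branching_sum[OF p, of n, folded T_def] ineq]
          mult_left_mono[OF coin_speed_sum[OF p]]]) simp
  also have "\<dots> = ennreal (C powr p * real T)" by (simp add: ennreal_mult)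
  finally have "real n * 4 ^ n / 4 \<le> C powr p * real T" by (subst (asm) ennreal_le_iff) auto
  then have "real n * 4 ^ n \<le> (16 * C powr p) * 4 ^ n" by (simp add: T_def)
  with n show False by simp
qed

section \<open>Transport to the real line\<close>

lemma doubling_transport:
  assumes "Metric_space M d" "Metric_space N e" "bij_betw g N M"
    and iso: "\<And>x y. x \<in> N \<Longrightarrow> y \<in> N \<Longrightarrow> e x y = d (g x) (g y)"
    and "doubling M d"
  shows "doubling N e"
proof -
  interpret M: Metric_space M d by fact
  interpret N: Metric_space N e by fact
  obtain l where l: "\<And>x r. x \<in> M \<Longrightarrow> r > 0 \<Longrightarrow> \<exists>C\<subseteq>M. finite C \<and> card C \<le> l \<and>
     M.mcball x r \<subseteq> (\<Union>c\<in>C. M.mcball c (r / 2))"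
    using assms(5) unfolding doubling_def by blast
  define h where "h = inv_into N g"
  have h: "h y \<in> N" "g (h y) = y" if "y \<in> M" for y
    using that assms(3) by (auto simp: h_def bij_betw_def inv_into_into f_inv_into_f)
  have gN: "g x \<in> M" if "x \<in> N" for x using that assms(3) by (auto simp: bij_betw_def)
  show ?thesis unfolding doubling_def
  proof (intro exI[of _ l] ballI allI impI)
    fix x r assume x: "x \<in> N" and r: "(r::real) > 0"
    obtain C where C: "C \<subseteq> M" "finite C" "card C \<le> l" "M.mcball (g x) r \<subseteq> (\<Union>c\<in>C. M.mcball c (r / 2))"
      using l[OF gN[OF x] r] by blast
    have "N.mcball x r \<subseteq> (\<Union>c\<in>h ` C. N.mcball c (r / 2))"
    proof
      fix y assume y: "y \<in> N.mcball x r"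
      then have "g y \<in> M.mcball (g x) r" using gN iso by (auto simp: M.in_mcball N.in_mcball)
      then obtain c where c: "c \<in> C" "g y \<in> M.mcball c (r / 2)" using C(4) by blast
      then have "y \<in> N.mcball (h c) (r / 2)"
        using y h[of c] iso[of "h c" y] by (auto simp: M.in_mcball N.in_mcball)
      with c(1) show "y \<in> (\<Union>c\<in>h ` C. N.mcball c (r / 2))" by blast
    qed
    moreover have "h ` C \<subseteq> N" "finite (h ` C)" "card (h ` C) \<le> l"
      using C(1-3) h(1) card_image_le[OF C(2), of h] by auto
    ultimately show "\<exists>C\<subseteq>N. finite C \<and> card C \<le> l \<and> N.mcball x r \<subseteq> (\<Union>c\<in>C. N.mcball c (r / 2))"
      by blast
  qed
qed

lemma markov_convex_transport:
  assumes "bij_betw g N M"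
    and iso: "\<And>x y. x \<in> N \<Longrightarrow> y \<in> N \<Longrightarrow> e x y = d (g x) (g y)"
    and "markov_convex N e p"
  shows "markov_convex M d p"
proof -
  define h where "h = inv_into N g"
  have h: "h y \<in> N" "g (h y) = y" if "y \<in> M" for y
    using that assms(1) by (auto simp: h_def bij_betw_def inv_into_into f_inv_into_f)
  obtain C where "C \<ge> 0" and C: "markov_convex_with N e p C"
    using assms(3) unfolding markov_convex_def by blast
  have "markov_convex_with M d p C"
    unfolding markov_convex_with_def
  proof (intro allI ballI impI)
    fix P :: "real measure" and K :: "int \<Rightarrow> nat \<Rightarrow> nat pmf" and X Y and f :: "nat \<Rightarrow> 'b"
    assume f: "f \<in> UNIV \<rightarrow> M" and X: "markov_chain P K X" and Y: "\<forall>k. independent_continuation P K X k (Y k)"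
    have "e (h (f a)) (h (f b)) = d (f a) (f b)" for a b
      using f h iso by (simp add: Pi_iff)
    moreover have "(\<lambda>a. h (f a)) \<in> UNIV \<rightarrow> N" using f h by auto
    ultimately show "(\<Sum>\<^sub>\<infinity>k::nat. \<Sum>\<^sub>\<infinity>t::int.
           (\<integral>\<^sup>+w. ennreal (d (f (X t w)) (f (Y (t - 2 ^ k) t w)) powr p) \<partial>P)
             / ennreal (2 powr (real k * p)))
        \<le> ennreal (C powr p) *
          (\<Sum>\<^sub>\<infinity>t::int. \<integral>\<^sup>+w. ennreal (d (f (X t w)) (f (X (t - 1) w)) powr p) \<partial>P)"
      using C[unfolded markov_convex_with_def, rule_format, of "\<lambda>a. h (f a)" P K X Y] X Y by simp
  qed
  with \<open>C \<ge> 0\<close> show ?thesis unfolding markov_convex_def by blast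
qed

theorem theorem1p5:
  "\<exists>(X :: real set) d. Metric_space X d \<and>
     (\<forall>p>0. \<not> markov_convex X d p) \<and>
     (\<lambda>n. distortion X d (tree_vertices n) (tree_dist n)) \<longlonglongrightarrow> \<infinity> \<and>
     doubling X d \<and>
     (\<exists>\<kappa>>0. \<forall>\<^sub>F n in sequentially.
        ereal (2 powr (\<kappa> * real n)) \<le> distortion X d (tree_vertices n) (tree_dist n))"
proof -
  define e where "e = (\<lambda>x. real (to_nat_on laakso_space x))"
  define X where "X = e ` laakso_space"
  define g where "g = inv_into laakso_space e"
  define d where "d = (\<lambda>a b. sup_dist (g a) (g b))"
  have "inj_on e laakso_space"
    using inj_on_to_nat_on[OF countable_laakso_space] by (auto simp: e_def inj_on_def)
  then have "bij_betw e laakso_space X" by (simp add: X_def inj_on_imp_bij_betw)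
  then have g: "bij_betw g X laakso_space" unfolding g_def by (rule bij_betw_inv_into)
  then have gX: "g a \<in> laakso_space" if "a \<in> X" for a
    using that by (auto simp: bij_betw_def)
  interpret L: Metric_space laakso_space sup_dist by (rule Metric_space_laakso)
  have metric: "Metric_space X d"
  proof
    show "0 \<le> d a b" "d a b = d b a" for a b by (simp_all add: d_def L.commute)
    show "d a b = 0 \<longleftrightarrow> a = b" if "a \<in> X" "b \<in> X" for a b
      using that gX g by (auto simp: d_def bij_betw_def dest: inj_onD)
    show "d a c \<le> d a b + d b c" if "a \<in> X" "b \<in> X" "c \<in> X" for a b c
      using that gX by (simp add: d_def L.triangle)
  qed
  have not_convex: "\<not> markov_convex X d p" if "p > 0" for p
    using markov_convex_transport[OF g, of d sup_dist p] not_markov_convex_laakso[OF that]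
    by (auto simp: d_def)
  have doubling: "doubling X d"
    by (rule doubling_transport[OF Metric_space_laakso metric g _ doubling_laakso]) (simp add: d_def)
  obtain \<kappa> where \<kappa>: "\<kappa> > 0" "\<forall>\<^sub>F n in sequentially.
        ereal (2 powr (\<kappa> * real n)) \<le> distortion X d (tree_vertices n) (tree_dist n)"
    using doubling_tree_distortion[OF metric doubling] by blast
  have "filterlim (\<lambda>n. 2 powr (\<kappa> * real n)) at_top sequentially"
    using \<kappa>(1) by real_asymp
  then have "(\<lambda>n. ereal (2 powr (\<kappa> * real n))) \<longlonglongrightarrow> \<infinity>"
    by (simp add: tendsto_PInfty_eq_at_top)
  then have "(\<lambda>n. distortion X d (tree_vertices n) (tree_dist n)) \<longlonglongrightarrow> \<infinity>"
    by (intro tendsto_sandwich[OF \<kappa>(2) _ _ tendsto_const]) simp_all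
  with metric not_convex doubling \<kappa> show ?thesis by blast
qed

end
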